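(* Let $Y=(Y,\succcurlyeq)$ be a Banach poset. Then $(\mathbb{R},Y)$ has the monotone Lipschitz extension property, where $\mathbb{R}$ carries its usual metric and usual order $\geq$.
   Context: All linear spaces are real. A partial order is a reflexive, transitive, antisymmetric binary relation. A vector order on a linear space $Y$ is a partial order $\succcurlyeq$ on $Y$ such that $x\succcurlyeq y$ implies $\lambda x\succcurlyeq\lambda y$ for all real $\lambda\geq 0$ and $x+z\succcurlyeq y+z$ for all $z\in Y$. A Banach poset is a Banach space $Y$ together with a vector order $\succcurlyeq$ that is a closed subset of $Y\times Y$; it is viewed as a metric space via its norm. A map $f$ between partially ordered sets is order-preserving if $x\succcurlyeq_X y$ implies $f(x)\succcurlyeq_Y f(y)$; a map between metric spaces is 1-Lipschitz if $d_Y(f(x),f(y))\leq d_X(x,y)$ for all $x,y$. A pair $(X,Y)$ of partially ordered metric spaces (metric spaces equipped with a partial order) has the monotone Lipschitz extension property if for every nonempty $S\subseteq X$ (with the induced metric and order) and every order-preserving 1-Lipschitz map $f:S\to Y$, there is an order-preserving 1-Lipschitz map $F:X\to Y$ with $F|_S=f$. *)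

theory Defs
  imports "HOL-Analysis.Analysis"
begin

text \<open>Orders are explicit relations, not instances of the class \<open>order\<close>, since
  a space may carry orders unrelated to any instance on its type. The relation \<open>R x y\<close>
  is always read as ``\<open>x\<close> is above \<open>y\<close>''.\<close>

definition is_partial_order :: "('a \<Rightarrow> 'a \<Rightarrow> bool) \<Rightarrow> bool" where
  "is_partial_order R \<longleftrightarrow> reflp R \<and> transp R \<and> antisymp R"

definition vector_order :: "('a::real_vector \<Rightarrow> 'a \<Rightarrow> bool) \<Rightarrow> bool" where
  "vector_order R \<longleftrightarrow> is_partial_order R \<and>
     (\<forall>x y. R x y \<longrightarrow>
        (\<forall>c::real. 0 \<le> c \<longrightarrow> R (c *\<^sub>R x) (c *\<^sub>R y)) \<and> (\<forall>z. R (x + z) (y + z)))"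

definition banach_poset :: "('a::banach \<Rightarrow> 'a \<Rightarrow> bool) \<Rightarrow> bool" where
  "banach_poset R \<longleftrightarrow> vector_order R \<and> closed {(x, y). R x y}"

text \<open>The two types carry the metrics of the spaces, the two relations their orders.
  A map on \<open>S\<close> is a total function of which only the values on \<open>S\<close> matter. The
  property is meant for relations satisfying \<open>is_partial_order\<close>; this is not part of
  the definition.\<close>

definition monotone_lipschitz_extension_property ::
    "('x::metric_space \<Rightarrow> 'x \<Rightarrow> bool) \<Rightarrow> ('y::metric_space \<Rightarrow> 'y \<Rightarrow> bool) \<Rightarrow> bool" where
  "monotone_lipschitz_extension_property RX RY \<longleftrightarrow>
     (\<forall>S f. S \<noteq> {} \<and> monotone_on S RX RY f \<and> 1-lipschitz_on S f \<longrightarrow>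
        (\<exists>F. monotone RX RY F \<and> 1-lipschitz_on UNIV F \<and> (\<forall>x\<in>S. F x = f x)))"

end

theory Submission
  imports Defs
begin

text \<open>
  For real \<open>x \<le> y\<close>, being order-preserving and \<open>1\<close>-Lipschitz says that the displacement
  \<open>(y - x, f y - f x)\<close> of the graph of \<open>f\<close> lies in a fixed convex cone of
  \<open>\<real> \<times> Y\<close>, the set of all \<open>(d, v)\<close> with \<open>v \<succeq> 0\<close> and \<open>\<parallel>v\<parallel> \<le> d\<close>. So the graph has to be
  extended to one whose left-to-right displacements stay in the cone.

  Since \<open>Y\<close> is complete, \<open>f\<close> extends to a \<open>1\<close>-Lipschitz map on the closure of its domain, and
  since the order is closed in \<open>Y \<times> Y\<close>, the extension is still order-preserving
  (\<open>ascending_on_closure\<close>). The complement of a closed set consists of disjoint open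
  intervals. On a bounded one the map is interpolated affinely between the two end points, on an
  unbounded one it is continued as a constant. A displacement within one interval, end points
  included, is a nonnegative multiple of a displacement between points of the domain, or has the
  form \<open>(d, 0)\<close> with \<open>d \<ge> 0\<close>. Any other displacement has a point of the domain between its
  end points, so it is a sum of displacements of these kinds and of one between points of the
  domain (\<open>ascending_on_interpolation\<close>). Convex cones are closed under nonnegative multiples and
  sums, so all displacements stay in the cone.
\<close>

section \<open>The cone of monotone nonexpansive displacements\<close>

definition displacement_cone :: "('a::real_normed_vector \<Rightarrow> 'a \<Rightarrow> bool) \<Rightarrow> (real \<times> 'a) set" where
  "displacement_cone R = {(d, v). R v 0 \<and> norm v \<le> d}"

definition ascending_on ::
    "('a::real_normed_vector \<Rightarrow> 'a \<Rightarrow> bool) \<Rightarrow> real set \<Rightarrow> (real \<Rightarrow> 'a) \<Rightarrow> bool" where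
  "ascending_on R T f \<longleftrightarrow>
     (\<forall>x\<in>T. \<forall>y\<in>T. x \<le> y \<longrightarrow> (y - x, f y - f x) \<in> displacement_cone R)"

lemma vector_order_diff_iff:
  assumes "vector_order R"
  shows "R (x - y) 0 \<longleftrightarrow> R x y"
proof
  assume "R (x - y) 0"
  then have "R (x - y + y) (0 + y)" using assms unfolding vector_order_def by blast
  then show "R x y" by simp
next
  assume "R x y"
  then have "R (x + - y) (y + - y)" using assms unfolding vector_order_def by blast
  then show "R (x - y) 0" by simp
qed

lemma vector_order_refl: "vector_order R \<Longrightarrow> R x x"
  unfolding vector_order_def is_partial_order_def by (auto dest: reflpD)

lemma vector_order_trans: "vector_order R \<Longrightarrow> R x y \<Longrightarrow> R y z \<Longrightarrow> R x z"
  unfolding vector_order_def is_partial_order_def by (auto dest: transpD)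

lemma displacement_cone_scale:
  assumes "vector_order R" "(d, v) \<in> displacement_cone R" "0 \<le> c"
  shows "(c * d, c *\<^sub>R v) \<in> displacement_cone R"
proof -
  have "R (c *\<^sub>R v) (c *\<^sub>R 0)"
    using assms unfolding vector_order_def displacement_cone_def by blast
  then show ?thesis
    using assms by (simp add: displacement_cone_def mult_left_mono)
qed

lemma displacement_cone_add:
  assumes R: "vector_order R"
    and d: "(d, v) \<in> displacement_cone R" and e: "(e, w) \<in> displacement_cone R"
  shows "(d + e, v + w) \<in> displacement_cone R"
proof -
  have "R (v + w) v"
    using e vector_order_diff_iff[OF R, of "v + w" v] by (simp add: displacement_cone_def)
  then have "R (v + w) 0"
    using d vector_order_trans[OF R] by (auto simp: displacement_cone_def)
  moreover have "norm (v + w) \<le> d + e"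
    using d e norm_triangle_ineq[of v w] by (simp add: displacement_cone_def)
  ultimately show ?thesis by (simp add: displacement_cone_def)
qed

lemma displacement_cone_trans:
  assumes "vector_order R"
    and "(y - x, q - p) \<in> displacement_cone R" and "(z - y, r - q) \<in> displacement_cone R"
  shows "(z - x, r - p) \<in> displacement_cone R"
  using displacement_cone_add[OF assms] by simp

lemma displacement_cone_zero:
  assumes "vector_order R" "0 \<le> d"
  shows "(d, 0) \<in> displacement_cone R"
  using assms by (simp add: displacement_cone_def vector_order_refl)

lemma ascending_on_iff:
  assumes R: "vector_order R"
  shows "ascending_on R T f \<longleftrightarrow> monotone_on T (\<ge>) R f \<and> 1-lipschitz_on T f"
proof
  assume f: "ascending_on R T f"
  have "dist (f x) (f y) \<le> 1 * dist x y" if "x \<in> T" "y \<in> T" for x y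
  proof (cases "x \<le> y")
    case True
    then show ?thesis using f that
      by (auto simp: ascending_on_def displacement_cone_def dist_norm norm_minus_commute)
  next
    case False
    then show ?thesis using f that
      by (auto simp: ascending_on_def displacement_cone_def dist_norm)
  qed
  then have "1-lipschitz_on T f" by (intro lipschitz_onI) auto
  moreover have "monotone_on T (\<ge>) R f"
    using f by (auto simp: ascending_on_def displacement_cone_def vector_order_diff_iff[OF R]
        intro!: monotone_onI)
  ultimately show "monotone_on T (\<ge>) R f \<and> 1-lipschitz_on T f" by simp
next
  assume f: "monotone_on T (\<ge>) R f \<and> 1-lipschitz_on T f"
  show "ascending_on R T f"
    unfolding ascending_on_def displacement_cone_def
  proof (clarsimp simp: vector_order_diff_iff[OF R], intro conjI)
    fix x y assume xy: "x \<in> T" "y \<in> T" "x \<le> y"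
    show "R (f y) (f x)" using f xy by (auto dest: monotone_onD)
    have "dist (f y) (f x) \<le> 1 * dist y x" using f xy by (auto dest: lipschitz_onD)
    then show "norm (f y - f x) \<le> y - x" using xy by (simp add: dist_norm)
  qed
qed

section \<open>Extension to the closure\<close>

text \<open>Points \<open>x < y\<close> of the closure are limits of points of \<open>S\<close> that are eventually in the
  same order, so a relation between the values at these points passes to the limit.\<close>

lemma ascending_on_closure:
  fixes R :: "'y::banach \<Rightarrow> 'y \<Rightarrow> bool"
  assumes R: "banach_poset R" and f: "ascending_on R S f"
  obtains g where "ascending_on R (closure S) g" "\<And>x. x \<in> S \<Longrightarrow> g x = f x"
proof -
  have V: "vector_order R" and cl: "closed {(x, y). R x y}"
    using R by (auto simp: banach_poset_def)
  obtain g where g: "1-lipschitz_on (closure S) g" and gf: "\<And>x. x \<in> S \<Longrightarrow> g x = f x"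
    using f lipschitz_extend_closure[of 1 S f] ascending_on_iff[OF V] by metis
  have "R (g y) (g x)" if x: "x \<in> closure S" and y: "y \<in> closure S" and "x \<le> y" for x y
  proof (cases "x = y")
    case True
    then show ?thesis by (simp add: vector_order_refl[OF V])
  next
    case False
    with \<open>x \<le> y\<close> have less: "x < y" by simp
    obtain u where u: "\<And>n. u n \<in> S" "u \<longlonglongrightarrow> x"
      using x by (auto simp: closure_sequential)
    obtain w where w: "\<And>n. w n \<in> S" "w \<longlonglongrightarrow> y"
      using y by (auto simp: closure_sequential)
    have cont: "continuous_on (closure S) g"
      using g lipschitz_on_continuous_on by blast
    have "\<forall>n. u n \<in> closure S" "\<forall>n. w n \<in> closure S"
      using u(1) w(1) closure_subset by blast+
    then have gu: "(\<lambda>n. g (u n)) \<longlonglongrightarrow> g x" and gw: "(\<lambda>n. g (w n)) \<longlonglongrightarrow> g y"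
      using continuous_on_tendsto_compose[OF cont u(2) x]
        continuous_on_tendsto_compose[OF cont w(2) y] by auto
    have "((\<lambda>n. (g (w n), g (u n))) \<longlongrightarrow> (g y, g x)) sequentially"
      by (intro tendsto_Pair gu gw)
    moreover have "eventually (\<lambda>n. 0 < w n - u n) sequentially"
      using order_tendstoD(1)[OF tendsto_diff[OF w(2) u(2)], of 0] less by simp
    then have "eventually (\<lambda>n. (g (w n), g (u n)) \<in> {(x, y). R x y}) sequentially"
    proof eventually_elim
      case (elim n)
      then show ?case
        using f u(1)[of n] w(1)[of n] gf
        by (auto simp: ascending_on_iff[OF V] dest!: monotone_onD[of _ _ _ _ "w n" "u n"])
    qed
    ultimately have "(g y, g x) \<in> {(x, y). R x y}"
      using Lim_in_closed_set[OF cl] by (metis sequentially_bot)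
    then show ?thesis by simp
  qed
  then have "monotone_on (closure S) (\<ge>) R g" by (auto intro: monotone_onI)
  with g gf that show thesis using ascending_on_iff[OF V] by blast
qed

section \<open>Interpolation across the gaps of a closed set\<close>

text \<open>For closed nonempty \<open>T\<close>, beyond an end of \<open>T\<close> both points below are the nearest point of
  \<open>T\<close>, so that unbounded gaps need no separate treatment: \<open>left_end T x = right_end T x\<close> makes
  the interpolation constant.\<close>

definition left_end :: "real set \<Rightarrow> real \<Rightarrow> real" where
  "left_end T x = (if T \<inter> {..x} = {} then Inf (T \<inter> {x..}) else Sup (T \<inter> {..x}))"

definition right_end :: "real set \<Rightarrow> real \<Rightarrow> real" where
  "right_end T x = (if T \<inter> {x..} = {} then Sup (T \<inter> {..x}) else Inf (T \<inter> {x..}))"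

text \<open>When \<open>left_end T x = right_end T x\<close>, the quotient is a division by zero with value
  \<open>0\<close>, and the interpolation takes the value at that common point.\<close>

definition interpolation :: "real set \<Rightarrow> (real \<Rightarrow> 'a::real_vector) \<Rightarrow> real \<Rightarrow> 'a" where
  "interpolation T g x = g (left_end T x) +
     ((x - left_end T x) / (right_end T x - left_end T x)) *\<^sub>R
       (g (right_end T x) - g (left_end T x))"

lemma Sup_below_in:
  fixes T :: "real set"
  assumes "closed T" "T \<inter> {..x} \<noteq> {}"
  shows "Sup (T \<inter> {..x}) \<in> T \<inter> {..x}"
  using assms by (intro closed_contains_Sup closed_Int) auto

lemma Inf_above_in:
  fixes T :: "real set"
  assumes "closed T" "T \<inter> {x..} \<noteq> {}"
  shows "Inf (T \<inter> {x..}) \<in> T \<inter> {x..}"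
  using assms by (intro closed_contains_Inf closed_Int) auto

lemma gap_ends_in:
  assumes "closed T" "T \<noteq> {}"
  shows "left_end T x \<in> T" "right_end T x \<in> T"
proof -
  obtain t where "t \<in> T" using assms by blast
  then have "T \<inter> {..x} \<noteq> {} \<or> T \<inter> {x..} \<noteq> {}" by (cases "t \<le> x") auto
  then show "left_end T x \<in> T" "right_end T x \<in> T"
    using Sup_below_in[OF assms(1), of x] Inf_above_in[OF assms(1), of x]
    by (auto simp: left_end_def right_end_def)
qed

lemma left_end_bounds:
  assumes "closed T" "t \<in> T" "t \<le> x"
  shows "t \<le> left_end T x" "left_end T x \<le> x"
proof -
  have ne: "T \<inter> {..x} \<noteq> {}" using assms by auto
  have "t \<le> Sup (T \<inter> {..x})" using assms by (intro cSup_upper) auto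
  then show "t \<le> left_end T x" using ne by (simp add: left_end_def)
  show "left_end T x \<le> x" using Sup_below_in[OF assms(1) ne] ne by (simp add: left_end_def)
qed

lemma right_end_bounds:
  assumes "closed T" "t \<in> T" "x \<le> t"
  shows "right_end T x \<le> t" "x \<le> right_end T x"
proof -
  have ne: "T \<inter> {x..} \<noteq> {}" using assms by auto
  have "Inf (T \<inter> {x..}) \<le> t" using assms by (intro cInf_lower) auto
  then show "right_end T x \<le> t" using ne by (simp add: right_end_def)
  show "x \<le> right_end T x" using Inf_above_in[OF assms(1) ne] ne by (simp add: right_end_def)
qed

lemma gap_ends_cases:
  assumes T: "closed T" "T \<noteq> {}"
  obtains "left_end T x = right_end T x"
  | "left_end T x < right_end T x" "left_end T x \<le> x" "x \<le> right_end T x"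
proof (cases "T \<inter> {..x} = {} \<or> T \<inter> {x..} = {}")
  case True
  moreover obtain t where "t \<in> T" using T by blast
  then have "T \<inter> {..x} \<noteq> {} \<or> T \<inter> {x..} \<noteq> {}" by (cases "t \<le> x") auto
  ultimately have "left_end T x = right_end T x" by (auto simp: left_end_def right_end_def)
  then show thesis by (rule that(1))
next
  case False
  then have "left_end T x \<le> x" "x \<le> right_end T x"
    using left_end_bounds(2)[OF T(1)] right_end_bounds(2)[OF T(1)] by auto
  then show thesis using that by fastforce
qed

lemma interpolation_on:
  assumes "closed T" "x \<in> T"
  shows "interpolation T g x = g x"
  using left_end_bounds[OF assms, of x] right_end_bounds[OF assms, of x]
  by (simp add: interpolation_def)

lemma gap_ends_const:
  assumes "T \<inter> {x..y} = {}" "x \<le> y"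
  shows "left_end T x = left_end T y" "right_end T x = right_end T y"
proof -
  have "T \<inter> {..x} = T \<inter> {..y}" "T \<inter> {x..} = T \<inter> {y..}"
    using assms by (fastforce simp: set_eq_iff)+
  then show "left_end T x = left_end T y" "right_end T x = right_end T y"
    by (simp_all add: left_end_def right_end_def)
qed

text \<open>Displacements along the affine piece through \<open>(a, g a)\<close> and \<open>(b, g b)\<close> are
  multiples of the displacement between these two points.\<close>

lemma affine_displacement:
  assumes R: "vector_order R" and g: "ascending_on R T g"
    and ab: "a \<in> T" "b \<in> T" "a < b" and d: "0 \<le> d"
  shows "(d, (d / (b - a)) *\<^sub>R (g b - g a)) \<in> displacement_cone R"
proof -
  have "(b - a, g b - g a) \<in> displacement_cone R" using g ab by (simp add: ascending_on_def)
  then have "(d / (b - a) * (b - a), (d / (b - a)) *\<^sub>R (g b - g a)) \<in> displacement_cone R"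
    by (rule displacement_cone_scale[OF R]) (use ab d in simp)
  then show ?thesis using ab by simp
qed

lemma interpolation_within_gap:
  assumes R: "vector_order R" and T: "closed T" "T \<noteq> {}" and g: "ascending_on R T g"
    and xy: "x \<le> y" "T \<inter> {x..y} = {}"
  shows "(y - x, interpolation T g y - interpolation T g x) \<in> displacement_cone R"
proof -
  define a where "a = left_end T x"
  define b where "b = right_end T x"
  have ab: "a \<in> T" "b \<in> T" using gap_ends_in[OF T] by (auto simp: a_def b_def)
  have "interpolation T g y - interpolation T g x =
      ((y - a) / (b - a)) *\<^sub>R (g b - g a) - ((x - a) / (b - a)) *\<^sub>R (g b - g a)"
    using gap_ends_const[OF xy(2,1)] by (simp add: interpolation_def a_def b_def)
  also have "\<dots> = ((y - x) / (b - a)) *\<^sub>R (g b - g a)"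
    by (simp add: scaleR_diff_left[symmetric] diff_divide_distrib[symmetric])
  finally have eq: "interpolation T g y - interpolation T g x =
      ((y - x) / (b - a)) *\<^sub>R (g b - g a)" .
  consider "a = b" | "a < b" using gap_ends_cases[OF T, of x] by (auto simp: a_def b_def)
  then show ?thesis
  proof cases
    case 1
    then show ?thesis using eq xy displacement_cone_zero[OF R] by simp
  next
    case 2
    then show ?thesis using eq xy affine_displacement[OF R g ab] by simp
  qed
qed

text \<open>The next two lemmas compare an arbitrary point with a point of \<open>T\<close> on either side, by
  stopping at the end of the gap in between.\<close>

lemma interpolation_from_left_end:
  assumes R: "vector_order R" and T: "closed T" and g: "ascending_on R T g"
    and t: "t \<in> T" "t \<le> x"
  shows "(x - t, interpolation T g x - g t) \<in> displacement_cone R"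
proof -
  define a where "a = left_end T x"
  define b where "b = right_end T x"
  have ne: "T \<noteq> {}" using t by blast
  have ab: "a \<in> T" "b \<in> T" using gap_ends_in[OF T ne] by (auto simp: a_def b_def)
  have a: "t \<le> a" "a \<le> x" using left_end_bounds[OF T t] by (auto simp: a_def)
  have F: "interpolation T g x - g a = ((x - a) / (b - a)) *\<^sub>R (g b - g a)"
    by (simp add: interpolation_def a_def b_def)
  have "(x - a, interpolation T g x - g a) \<in> displacement_cone R"
    using gap_ends_cases[OF T ne, of x]
  proof cases
    case 1
    then show ?thesis using F a displacement_cone_zero[OF R] by (simp add: a_def b_def)
  next
    case 2
    then show ?thesis using F a affine_displacement[OF R g ab] by (simp add: a_def b_def)
  qed
  moreover have "(a - t, g a - g t) \<in> displacement_cone R"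
    using g t ab a by (simp add: ascending_on_def)
  ultimately show ?thesis using displacement_cone_trans[OF R] by blast
qed

lemma interpolation_to_right_end:
  assumes R: "vector_order R" and T: "closed T" and g: "ascending_on R T g"
    and t: "t \<in> T" "x \<le> t"
  shows "(t - x, g t - interpolation T g x) \<in> displacement_cone R"
proof -
  define a where "a = left_end T x"
  define b where "b = right_end T x"
  have ne: "T \<noteq> {}" using t by blast
  have ab: "a \<in> T" "b \<in> T" using gap_ends_in[OF T ne] by (auto simp: a_def b_def)
  have b: "b \<le> t" "x \<le> b" using right_end_bounds[OF T t] by (auto simp: b_def)
  have F: "interpolation T g x = g a + ((x - a) / (b - a)) *\<^sub>R (g b - g a)"
    by (simp add: interpolation_def a_def b_def)
  have "(b - x, g b - interpolation T g x) \<in> displacement_cone R"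
    using gap_ends_cases[OF T ne, of x]
  proof cases
    case 1
    then show ?thesis using F b displacement_cone_zero[OF R] by (simp add: a_def b_def)
  next
    case 2
    then have less: "a < b" by (simp add: a_def b_def)
    have "g b - interpolation T g x = (1 - (x - a) / (b - a)) *\<^sub>R (g b - g a)"
      unfolding F by (simp add: algebra_simps)
    also have "1 - (x - a) / (b - a) = (b - x) / (b - a)"
      using less by (simp add: field_simps)
    finally show ?thesis using b less affine_displacement[OF R g ab] by simp
  qed
  moreover have "(t - b, g t - g b) \<in> displacement_cone R"
    using g t ab b by (simp add: ascending_on_def)
  ultimately show ?thesis using displacement_cone_trans[OF R] by blast
qed

lemma ascending_on_interpolation:
  assumes R: "vector_order R" and T: "closed T" "T \<noteq> {}" and g: "ascending_on R T g"
  shows "ascending_on R UNIV (interpolation T g)"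
  unfolding ascending_on_def
proof (intro ballI impI)
  fix x y :: real assume xy: "x \<le> y"
  show "(y - x, interpolation T g y - interpolation T g x) \<in> displacement_cone R"
  proof (cases "T \<inter> {x..y} = {}")
    case True
    then show ?thesis using interpolation_within_gap[OF R T g xy] by blast
  next
    case False
    then obtain t where t: "t \<in> T" "x \<le> t" "t \<le> y" by auto
    show ?thesis
      using displacement_cone_trans[OF R interpolation_to_right_end[OF R T(1) g t(1,2)]
          interpolation_from_left_end[OF R T(1) g t(1,3)]] .
  qed
qed

section \<open>The extension property\<close>

theorem theorem2:
  fixes R :: "'y::banach \<Rightarrow> 'y \<Rightarrow> bool"
  assumes "banach_poset R"
  shows "monotone_lipschitz_extension_property ((\<ge>) :: real \<Rightarrow> real \<Rightarrow> bool) R"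
  unfolding monotone_lipschitz_extension_property_def
proof (intro allI impI, elim conjE)
  fix S :: "real set" and f :: "real \<Rightarrow> 'y"
  assume S: "S \<noteq> {}" and mono: "monotone_on S (\<ge>) R f" and lip: "1-lipschitz_on S f"
  have V: "vector_order R" using assms by (simp add: banach_poset_def)
  have "ascending_on R S f" using mono lip by (simp add: ascending_on_iff[OF V])
  then obtain g where g: "ascending_on R (closure S) g" and gf: "\<And>x. x \<in> S \<Longrightarrow> g x = f x"
    using ascending_on_closure[OF assms] by blast
  define F where "F = interpolation (closure S) g"
  have "ascending_on R UNIV F"
    unfolding F_def using ascending_on_interpolation[OF V _ _ g] S by simp
  then have "monotone (\<ge>) R F" "1-lipschitz_on UNIV F"
    by (simp_all add: ascending_on_iff[OF V])
  moreover have "F x = f x" if "x \<in> S" for x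
  proof -
    have "x \<in> closure S" using that closure_subset by blast
    then show ?thesis using that by (simp add: F_def interpolation_on gf)
  qed
  ultimately show "\<exists>F. monotone (\<ge>) R F \<and> 1-lipschitz_on UNIV F \<and> (\<forall>x\<in>S. F x = f x)"
    by blast
qed

end
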